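(* Let $h=(h_n)_{n\geq 1}$ be a sequence of integers. Then $h$ is relatively realizable if and only if $\operatorname{orb}(h)$ is a sequence of integers, i.e. if and only if $\frac{1}{n}\sum_{d\mid n}\mu\left(\frac{n}{d}\right)h_d\in\mathbb{Z}$ for all $n\geq 1$.
   Context: A (topological) dynamical system $(X,T)$ consists of a topological space $X$ and a continuous map $T:X\to X$. Its fixed point counts sequence is $(a_n)_{n\ge1}$ with $a_n=|\{x\in X: T^n(x)=x\}|$. Standing assumption: for all dynamical systems considered, $a_n$ is finite for every $n\geq 1$. A (topological) factor of a dynamical system $(X,T)$ is a dynamical system $(Y,S)$ for which there is a continuous surjection $\phi:X\to Y$ with $\phi(T(x))=S(\phi(x))$ for all $x\in X$. An integer sequence $h=(h_n)_{n\geq 1}$ is called relatively realizable if there is a dynamical system $(X,T)$ and a factor $(Y,S)$ of it, with fixed point counts sequences $f$ and $g$ respectively (all counts finite), such that $h=f-g$, i.e. $h_n=f_n-g_n$ for all $n\ge 1$. For a sequence $a=(a_n)_{n\geq1}$, the sequence $\operatorname{orb}(a)$ is defined by $\operatorname{orb}(a)_n=\frac1n\sum_{d\mid n}\mu\left(\frac nd\right)a_d$, where $\mu$ is the Möbius function. *)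

theory Defs
  imports "HOL-Analysis.Analysis" "HOL-Computational_Algebra.Squarefree"
begin

text \<open>
  A space is a value of type \<^typ>\<open>'a topology\<close>, so that its points form an arbitrary subset
  \<open>topspace X\<close> of the type \<open>'a\<close>; no separation axiom, compactness or nonemptiness is required.
  The behaviour of maps outside the carrier is irrelevant.
\<close>

definition dynamical_system :: "'a topology \<Rightarrow> ('a \<Rightarrow> 'a) \<Rightarrow> bool" where
  "dynamical_system X T \<longleftrightarrow> continuous_map X X T"

definition fixed_points :: "'a topology \<Rightarrow> ('a \<Rightarrow> 'a) \<Rightarrow> nat \<Rightarrow> 'a set" where
  "fixed_points X T n = {x \<in> topspace X. (T ^^ n) x = x}"

definition finite_fixed_points :: "'a topology \<Rightarrow> ('a \<Rightarrow> 'a) \<Rightarrow> bool" where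
  "finite_fixed_points X T \<longleftrightarrow> (\<forall>n\<ge>1. finite (fixed_points X T n))"

definition fixed_point_count :: "'a topology \<Rightarrow> ('a \<Rightarrow> 'a) \<Rightarrow> nat \<Rightarrow> nat" where
  "fixed_point_count X T n = card (fixed_points X T n)"

definition is_factor ::
    "'a topology \<Rightarrow> ('a \<Rightarrow> 'a) \<Rightarrow> 'b topology \<Rightarrow> ('b \<Rightarrow> 'b) \<Rightarrow> bool" where
  "is_factor X T Y S \<longleftrightarrow> dynamical_system X T \<and> dynamical_system Y S \<and>
     (\<exists>\<phi>. continuous_map X Y \<phi> \<and> \<phi> ` topspace X = topspace Y \<and>
          (\<forall>x\<in>topspace X. \<phi> (T x) = S (\<phi> x)))"

text \<open>
  HOL cannot quantify over types inside a formula, so the types from which the points of the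
  system and of its factor are drawn are parameters. Sequences are indexed by \<open>n \<ge> 1\<close>; the value
  at \<open>0\<close> is ignored.
\<close>

definition relatively_realizable :: "'a itself \<Rightarrow> 'b itself \<Rightarrow> (nat \<Rightarrow> int) \<Rightarrow> bool" where
  "relatively_realizable _ _ h \<longleftrightarrow>
     (\<exists>(X :: 'a topology) T (Y :: 'b topology) S.
        is_factor X T Y S \<and> finite_fixed_points X T \<and> finite_fixed_points Y S \<and>
        (\<forall>n\<ge>1. h n = int (fixed_point_count X T n) - int (fixed_point_count Y S n)))"

definition moebius :: "nat \<Rightarrow> int" where
  "moebius n = (if squarefree n then (-1) ^ card (prime_factors n) else 0)"

definition orb :: "(nat \<Rightarrow> int) \<Rightarrow> nat \<Rightarrow> rat" where
  "orb a n = 1 / of_nat n * (\<Sum>d | d dvd n. of_int (moebius (n div d)) * of_int (a d))"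

end

theory Submission
  imports Defs
begin

text \<open>
  By Moebius inversion, \<open>n * orb f n\<close> is the number of points of least period \<open>n\<close> of a system with
  fixed point counts \<open>f\<close>. These points form cycles of length \<open>n\<close>, so \<open>orb f n\<close> is an integer, and
  integrality for \<open>f - g\<close> follows by linearity.

  Conversely, let \<open>c = orb h\<close> be integral and write \<open>c = p - q\<close> with \<open>p, q \<ge> 1\<close>. Let \<open>Y\<close> be the discrete
  system with \<open>q n\<close> cycles of each length \<open>n\<close>. A cycle is a factor of an infinite ray, which has no
  periodic points. Hence the system \<open>X\<close> consisting of \<open>p n\<close> cycles of each length \<open>n\<close> and of one ray
  for each cycle of \<open>Y\<close> maps onto \<open>Y\<close>, if its cycles are collapsed to a fixed point of \<open>Y\<close>; the
  difference of the counts is the sum of \<open>d * c d\<close> over \<open>d dvd n\<close>, which is \<open>h n\<close>.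
\<close>

section \<open>Moebius inversion\<close>

lemma prod_prime_factors_squarefree:
  fixes n :: nat
  assumes "squarefree n"
  shows "\<Prod>(prime_factors n) = n"
proof -
  have "n \<noteq> 0"
    using assms by (metis not_squarefree_0)
  then have "n = (\<Prod>p\<in>prime_factors n. p ^ multiplicity p n)"
    by (simp add: prime_factorization_nat)
  also have "\<dots> = \<Prod>(prime_factors n)"
    using assms \<open>n \<noteq> 0\<close>
    by (intro prod.cong) (auto simp: squarefree_factorial_semiring')
  finally show ?thesis ..
qed

text \<open>The inverse is the product of a set of primes. This turns sums over squarefree divisors
  into sums over subsets of \<open>prime_factors n\<close>.\<close>

lemma bij_betw_prime_factors_squarefree_divisors:
  fixes n :: nat
  assumes "n > 0"
  shows "bij_betw prime_factors {d. d dvd n \<and> squarefree d} (Pow (prime_factors n))"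
proof (rule bij_betwI[where g = "\<Prod>"])
  have subset_prime_factors:
    "finite A" "\<And>p. p \<in> A \<Longrightarrow> prime p" "prime_factors (\<Prod>A) = A" if "A \<subseteq> prime_factors n" for A
  proof -
    show "finite A"
      using that by (rule finite_subset) simp
    show *: "prime p" if "p \<in> A" for p
      using that \<open>A \<subseteq> prime_factors n\<close> by auto
    have "0 \<notin> A"
      using * by (metis not_prime_0)
    then have "prime_factors (\<Prod>A) = (\<Union>p\<in>A. prime_factors p)"
      using prime_factors_prod[OF \<open>finite A\<close>, of "\<lambda>p. p"] by simp
    also have "\<dots> = (\<Union>p\<in>A. {p})"
      using * by (intro SUP_cong) (auto simp: prime_prime_factors)
    finally show "prime_factors (\<Prod>A) = A" by simp
  qed
  show "\<Prod> \<in> Pow (prime_factors n) \<rightarrow> {d. d dvd n \<and> squarefree d}"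
  proof (intro funcsetI CollectI conjI)
    fix A assume "A \<in> Pow (prime_factors n)"
    then have A: "A \<subseteq> prime_factors n" by simp
    show "squarefree (\<Prod>A)"
      using subset_prime_factors[OF A]
      by (intro squarefree_prod_coprime) (auto intro: primes_coprime squarefree_prime)
    have "(\<Prod>p\<in>A. p) dvd (\<Prod>p\<in>prime_factors n. p ^ multiplicity p n)"
      using A by (intro prod_dvd_prod_subset2 finite_set_mset)
        (auto intro!: dvd_power simp: prime_factors_multiplicity)
    then show "\<Prod>A dvd n"
      using \<open>n > 0\<close> by (simp flip: prime_factorization_nat)
  qed
  show "prime_factors \<in> {d. d dvd n \<and> squarefree d} \<rightarrow> Pow (prime_factors n)"
    using \<open>n > 0\<close> by (auto simp: prime_factors_dvd intro: dvd_trans)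
  show "prime_factors (\<Prod>A) = A" if "A \<in> Pow (prime_factors n)" for A
    using that by (simp add: subset_prime_factors)
  show "\<Prod>(prime_factors d) = d" if "d \<in> {d. d dvd n \<and> squarefree d}" for d
    using that by (simp add: prod_prime_factors_squarefree)
qed

text \<open>Only squarefree divisors contribute, so this is the alternating sum over all sets of
  primes dividing \<open>n\<close>. It is the expansion of a product of factors
  \<open>-1 + 1\<close>, which vanishes unless \<open>n\<close> has no prime factor.\<close>

lemma sum_moebius_divisors:
  assumes "n > 0"
  shows "(\<Sum>d | d dvd n. moebius d) = (if n = 1 then 1 else 0)"
proof -
  have "(\<Sum>d | d dvd n. moebius d) = (\<Sum>d | d dvd n \<and> squarefree d. (-1) ^ card (prime_factors d))"
    using assms by (intro sum.mono_neutral_cong_right) (auto simp: moebius_def)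
  also have "\<dots> = (\<Sum>A\<in>Pow (prime_factors n). (-1) ^ card A)"
    using bij_betw_prime_factors_squarefree_divisors[OF assms] by (rule sum.reindex_bij_betw)
  also have "\<dots> = (\<Prod>p\<in>prime_factors n. -1 + 1)"
    using prod_add[of "prime_factors n" "\<lambda>_. -1 :: int" "\<lambda>_. 1"] by simp
  also have "\<dots> = (if n = 1 then 1 else 0)"
    using assms by (auto simp: prime_factorization_empty_iff power_0_left)
  finally show ?thesis .
qed

text \<open>Substitute \<open>d = e * k\<close> in the first sum and \<open>d = n div k\<close> in
  the second. Both inversion formulas reduce their inner sums to \<open>sum_moebius_divisors\<close>
  in this way.\<close>

lemma sum_dvd_interval:
  fixes g :: "nat \<Rightarrow> 'a :: comm_monoid_add"
  assumes "n > 0" "e dvd n"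
  shows "(\<Sum>d | e dvd d \<and> d dvd n. g (d div e)) = (\<Sum>k | k dvd n div e. g k)"
    and "(\<Sum>d | e dvd d \<and> d dvd n. g (n div d)) = (\<Sum>k | k dvd n div e. g k)"
proof -
  obtain m where n: "n = e * m" and "e > 0" "m > 0"
    using assms by (auto elim!: dvdE)
  show "(\<Sum>d | e dvd d \<and> d dvd n. g (d div e)) = (\<Sum>k | k dvd n div e. g k)"
    using \<open>e > 0\<close> by (intro sum.reindex_bij_witness[where i = "\<lambda>k. e * k" and j = "\<lambda>d. d div e"])
      (auto simp: n elim!: dvdE)
  show "(\<Sum>d | e dvd d \<and> d dvd n. g (n div d)) = (\<Sum>k | k dvd n div e. g k)"
    using \<open>e > 0\<close> \<open>m > 0\<close>
    by (intro sum.reindex_bij_witness[where i = "\<lambda>k. n div k" and j = "\<lambda>d. n div d"])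
      (auto simp: n elim!: dvdE)
qed

text \<open>After swapping the sums, the coefficient of \<open>g e\<close> is the sum of
  \<open>moebius\<close> over the divisors of \<open>n div e\<close>, which is 0 unless
  \<open>e = n\<close>. The hypothesis concerns divisors of \<open>n\<close> only, so the arbitrary
  values at index 0 never enter.\<close>

lemma moebius_inversion:
  assumes "n > 0" and "\<And>d. d dvd n \<Longrightarrow> f d = (\<Sum>e | e dvd d. g e)"
  shows "(\<Sum>d | d dvd n. moebius (n div d) * f d) = g n"
proof -
  have "(\<Sum>d | d dvd n. moebius (n div d) * f d)
      = (\<Sum>d | d dvd n. \<Sum>e | e dvd n \<and> e dvd d. moebius (n div d) * g e)"
    using assms by (intro sum.cong) (auto simp: sum_distrib_left intro!: sum.cong intro: dvd_trans)
  also have "\<dots> = (\<Sum>e | e dvd n. \<Sum>d | d dvd n \<and> e dvd d. moebius (n div d) * g e)"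
    using assms sum.swap_restrict[of "{d. d dvd n}" "{d. d dvd n}" _ "\<lambda>d e. e dvd d"] by simp
  also have "\<dots> = (\<Sum>e | e dvd n. (\<Sum>d | e dvd d \<and> d dvd n. moebius (n div d)) * g e)"
    by (simp add: sum_distrib_right conj_commute)
  also have "\<dots> = (\<Sum>e | e dvd n. if e = n then g e else 0)"
  proof (intro sum.cong refl)
    fix e assume "e \<in> {e. e dvd n}"
    then have "e dvd n" "n div e > 0" "n div e = 1 \<longleftrightarrow> e = n"
      using assms(1) by (auto elim!: dvdE)
    then show "(\<Sum>d | e dvd d \<and> d dvd n. moebius (n div d)) * g e = (if e = n then g e else 0)"
      using assms(1) by (simp add: sum_dvd_interval(2) sum_moebius_divisors)
  qed
  also have "\<dots> = g n"
    using assms(1) by simp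
  finally show ?thesis .
qed

text \<open>The opposite direction: summing the transform over divisors recovers the sequence. The
  same swap works, now with \<open>d div e\<close> inside.\<close>

lemma moebius_inversion':
  assumes "n > 0" and "\<And>d. d dvd n \<Longrightarrow> g d = (\<Sum>e | e dvd d. moebius (d div e) * f e)"
  shows "(\<Sum>d | d dvd n. g d) = f n"
proof -
  have "(\<Sum>d | d dvd n. g d)
      = (\<Sum>d | d dvd n. \<Sum>e | e dvd n \<and> e dvd d. moebius (d div e) * f e)"
    using assms by (intro sum.cong) (auto intro!: sum.cong intro: dvd_trans)
  also have "\<dots> = (\<Sum>e | e dvd n. \<Sum>d | d dvd n \<and> e dvd d. moebius (d div e) * f e)"
    using assms sum.swap_restrict[of "{d. d dvd n}" "{d. d dvd n}" _ "\<lambda>d e. e dvd d"] by simp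
  also have "\<dots> = (\<Sum>e | e dvd n. (\<Sum>d | e dvd d \<and> d dvd n. moebius (d div e)) * f e)"
    by (simp add: sum_distrib_right conj_commute)
  also have "\<dots> = (\<Sum>e | e dvd n. if e = n then f e else 0)"
  proof (intro sum.cong refl)
    fix e assume "e \<in> {e. e dvd n}"
    then have "e dvd n" "n div e > 0" "n div e = 1 \<longleftrightarrow> e = n"
      using assms(1) by (auto elim!: dvdE)
    then show "(\<Sum>d | e dvd d \<and> d dvd n. moebius (d div e)) * f e = (if e = n then f e else 0)"
      using assms(1) by (simp add: sum_dvd_interval(1) sum_moebius_divisors)
  qed
  also have "\<dots> = f n"
    using assms(1) by simp
  finally show ?thesis .
qed

lemma orb_in_Ints_iff:
  assumes "n > 0"
  shows "orb a n \<in> \<int> \<longleftrightarrow> int n dvd (\<Sum>d | d dvd n. moebius (n div d) * a d)"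
    (is "_ \<longleftrightarrow> _ dvd ?s")
proof -
  have "orb a n = of_int ?s / of_int (int n)"
    by (simp add: orb_def)
  then show ?thesis
    using assms by (simp only: of_int_div_of_int_in_Ints_iff) simp
qed

section \<open>Fixed point counts\<close>

text \<open>For \<open>n = 0\<close> this is the whole carrier, hence the positivity assumptions
  below.\<close>

definition least_period_points :: "'a topology \<Rightarrow> ('a \<Rightarrow> 'a) \<Rightarrow> nat \<Rightarrow> 'a set" where
  "least_period_points X T n =
     {x \<in> fixed_points X T n. \<forall>k. 0 < k \<longrightarrow> k < n \<longrightarrow> (T ^^ k) x \<noteq> x}"

text \<open>Only the remainder of \<open>m\<close> modulo \<open>n\<close> matters, and a nonzero
  remainder is too small to be a period.\<close>

lemma least_period_dvd:
  assumes "x \<in> least_period_points X T n" "n > 0"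
  shows "(T ^^ m) x = x \<longleftrightarrow> n dvd m"
proof -
  have "(T ^^ m) x = (T ^^ (m mod n)) x"
    using assms by (simp add: funpow_mod_eq least_period_points_def fixed_points_def)
  moreover have "(T ^^ (m mod n)) x = x \<longleftrightarrow> m mod n = 0"
    using assms by (auto simp: least_period_points_def)
  ultimately show ?thesis by auto
qed

lemma fixed_points_eq_UN_least_period_points:
  assumes "n > 0"
  shows "fixed_points X T n = (\<Union>d\<in>{d. d dvd n}. least_period_points X T d)"
proof (intro equalityI subsetI)
  fix x assume x: "x \<in> fixed_points X T n"
  define d where "d = (LEAST d. 0 < d \<and> (T ^^ d) x = x)"
  have d: "0 < d" "(T ^^ d) x = x"
    using LeastI[of "\<lambda>d. 0 < d \<and> (T ^^ d) x = x" n] x assms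
    by (auto simp: d_def fixed_points_def)
  moreover have "(T ^^ k) x \<noteq> x" if "0 < k" "k < d" for k
    using not_less_Least[of k "\<lambda>d. 0 < d \<and> (T ^^ d) x = x"] that by (auto simp: d_def)
  ultimately have "x \<in> least_period_points X T d"
    using x by (simp add: least_period_points_def fixed_points_def)
  then show "x \<in> (\<Union>d\<in>{d. d dvd n}. least_period_points X T d)"
    using x d(1) least_period_dvd[of x X T d n] by (auto simp: fixed_points_def)
next
  fix x assume "x \<in> (\<Union>d\<in>{d. d dvd n}. least_period_points X T d)"
  then obtain d where d: "d dvd n" "x \<in> least_period_points X T d" by auto
  with assms have "d > 0" by (auto intro: Nat.gr0I)
  with d have "(T ^^ n) x = x"
    by (simp add: least_period_dvd)
  with d show "x \<in> fixed_points X T n"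
    by (simp add: fixed_points_def least_period_points_def)
qed

lemma fixed_point_count_eq_sum:
  assumes "finite_fixed_points X T" "n > 0"
  shows "fixed_point_count X T n = (\<Sum>d | d dvd n. card (least_period_points X T d))"
  unfolding fixed_point_count_def fixed_points_eq_UN_least_period_points[OF assms(2)]
proof (rule card_UN_disjoint)
  show "finite {d. d dvd n}"
    using assms(2) by simp
  show "\<forall>d\<in>{d. d dvd n}. finite (least_period_points X T d)"
  proof
    fix d assume "d \<in> {d. d dvd n}"
    then have "d \<ge> 1"
      using assms(2) by (cases d) auto
    then have "finite (fixed_points X T d)"
      using assms(1) by (simp add: finite_fixed_points_def)
    then show "finite (least_period_points X T d)"
      by (rule rev_finite_subset) (auto simp: least_period_points_def)
  qed
  \<comment> \<open>Two least periods of one point divide each other.\<close>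
  have "d = e" if "x \<in> least_period_points X T d" "x \<in> least_period_points X T e"
    "d dvd n" "e dvd n" for d e x
  proof -
    have "d > 0" "e > 0"
      using that assms(2) by (auto intro: Nat.gr0I)
    then show ?thesis
      using least_period_dvd[OF that(1), of e] least_period_dvd[OF that(2), of d]
        least_period_dvd[OF that(1), of d] least_period_dvd[OF that(2), of e]
      by (simp add: dvd_antisym)
  qed
  then show "\<forall>d\<in>{d. d dvd n}. \<forall>e\<in>{d. d dvd n}. d \<noteq> e \<longrightarrow>
      least_period_points X T d \<inter> least_period_points X T e = {}"
    by blast
qed

text \<open>A further iterate leads from \<open>(T ^^ i) x\<close> back to \<open>x\<close>, and
  iterates of \<open>T\<close> commute. So \<open>T ^^ k\<close> fixes one of these two points iff
  it fixes the other.\<close>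

lemma funpow_least_period_points:
  assumes "T ` topspace X \<subseteq> topspace X" "x \<in> least_period_points X T n" "n > 0"
  shows "(T ^^ i) x \<in> least_period_points X T n"
proof -
  have commute: "(T ^^ k) ((T ^^ j) y) = (T ^^ j) ((T ^^ k) y)" for j k y
    using funpow_add[of j k T] funpow_add[of k j T] by (simp add: add.commute fun_eq_iff)
  have "(T ^^ (n - i mod n)) ((T ^^ i) x) = x"
  proof -
    have "n - i mod n + i = n - i mod n + (i mod n + n * (i div n))"
      by simp
    also have "\<dots> = n + n * (i div n)"
      using mod_less_divisor[OF \<open>n > 0\<close>, of i] by linarith
    finally have "n dvd n - i mod n + i"
      by simp
    then show ?thesis
      using least_period_dvd[OF assms(2,3), of "n - i mod n + i"] by (simp add: funpow_add)
  qed
  then have "(T ^^ k) ((T ^^ i) x) = (T ^^ i) x \<longleftrightarrow> (T ^^ k) x = x" for k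
    by (metis commute)
  moreover have "(T ^^ i) x \<in> topspace X"
    using assms by (induction i) (auto simp: least_period_points_def fixed_points_def)
  ultimately show ?thesis
    using assms(2) by (auto simp: least_period_points_def fixed_points_def)
qed

text \<open>Lying on the same forward orbit is an equivalence relation on these points, and each
  class is a cycle with exactly \<open>n\<close> elements.\<close>

lemma dvd_card_least_period_points:
  assumes "T ` topspace X \<subseteq> topspace X" "finite (least_period_points X T n)" "n > 0"
  shows "n dvd card (least_period_points X T n)"
proof -
  define L where "L = least_period_points X T n"
  define r where "r = {(x, y). x \<in> L \<and> (\<exists>i. y = (T ^^ i) x)}"
  have closed: "(T ^^ i) x \<in> L" if "x \<in> L" for x i
    using that funpow_least_period_points[OF assms(1) _ assms(3)] by (simp add: L_def)
  have period: "(T ^^ m) x = x \<longleftrightarrow> n dvd m" if "x \<in> L" for x m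
    using that assms(3) least_period_dvd by (simp add: L_def)
  have "equiv L r"
  proof (rule equivI)
    show "r \<subseteq> L \<times> L"
      using closed by (auto simp: r_def)
    show "refl_on L r"
      by (auto simp: refl_on_def r_def intro: exI[of _ 0])
    show "sym r"
    proof (rule symI)
      fix x y assume "(x, y) \<in> r"
      then obtain i where "x \<in> L" "y = (T ^^ i) x"
        by (auto simp: r_def)
      \<comment> \<open>Together with the first \<open>i\<close> steps this makes
        \<open>n * i\<close> steps, that is, \<open>i\<close> full turns of the cycle.\<close>
      moreover have "(T ^^ (n * i - i)) ((T ^^ i) x) = x"
      proof -
        have "n * i - i + i = n * i"
          using assms(3) by (cases n) auto
        then have "(T ^^ (n * i - i)) ((T ^^ i) x) = (T ^^ (n * i)) x"
          using funpow_add[of "n * i - i" i T] by simp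
        then show ?thesis
          using period[OF \<open>x \<in> L\<close>] by simp
      qed
      ultimately show "(y, x) \<in> r"
        using closed by (auto simp: r_def intro: exI[of _ "n * i - i"])
    qed
    show "trans r"
    proof (rule transI)
      fix x y z assume "(x, y) \<in> r" "(y, z) \<in> r"
      then obtain i j where "x \<in> L" "z = (T ^^ j) ((T ^^ i) x)"
        by (auto simp: r_def)
      then show "(x, z) \<in> r"
        by (auto simp: r_def funpow_add intro: exI[of _ "j + i"])
    qed
  qed
  moreover have "n dvd card C" if C: "C \<in> L // r" for C
  proof -
    obtain x where x: "x \<in> L" "C = r `` {x}"
      using C by (rule quotientE)
    have "C = (\<lambda>i. (T ^^ i) x) ` {..<n}"
    proof -
      have "(T ^^ i) x = (T ^^ (i mod n)) x" for i
        using x period[of x n] by (simp add: funpow_mod_eq)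
      then show ?thesis
        using x assms(3) by (fastforce simp: r_def)
    qed
    moreover have "inj_on (\<lambda>i. (T ^^ i) x) {..<n}"
    proof (rule linorder_inj_onI')
      fix i j assume "i \<in> {..<n}" "j \<in> {..<n}" "i < j"
      have "(T ^^ (j - i)) ((T ^^ i) x) = (T ^^ j) x"
        using \<open>i < j\<close> funpow_add[of "j - i" i T] by simp
      \<comment> \<open>Here \<open>0 < j - i < n\<close>, so \<open>n\<close> does not divide
        \<open>j - i\<close>.\<close>
      moreover have "(T ^^ (j - i)) ((T ^^ i) x) \<noteq> (T ^^ i) x"
        using period[OF closed[OF x(1)]] \<open>i < j\<close> \<open>j \<in> {..<n}\<close> by (auto dest: dvd_imp_le)
      ultimately show "(T ^^ i) x \<noteq> (T ^^ j) x"
        by simp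
    qed
    ultimately show ?thesis
      by (simp add: card_image)
  qed
  ultimately show ?thesis
    using assms(2) equiv_imp_dvd_card unfolding L_def by blast
qed

text \<open>Inversion identifies the sum with the number of points of least period
  \<open>n\<close>.\<close>

lemma dvd_sum_moebius_fixed_point_count:
  assumes "dynamical_system X T" "finite_fixed_points X T" "n > 0"
  shows "int n dvd (\<Sum>d | d dvd n. moebius (n div d) * int (fixed_point_count X T d))"
proof -
  have "(\<Sum>d | d dvd n. moebius (n div d) * int (fixed_point_count X T d))
      = int (card (least_period_points X T n))"
  proof (rule moebius_inversion[OF \<open>n > 0\<close>])
    fix d assume "d dvd n"
    then have "d > 0"
      using \<open>n > 0\<close> by (auto intro: Nat.gr0I)
    then show "int (fixed_point_count X T d) = (\<Sum>e | e dvd d. int (card (least_period_points X T e)))"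
      using assms(2) by (simp add: fixed_point_count_eq_sum)
  qed
  moreover have "n dvd card (least_period_points X T n)"
  proof (rule dvd_card_least_period_points)
    show "T ` topspace X \<subseteq> topspace X"
      using assms(1) by (simp add: dynamical_system_def continuous_map_image_subset_topspace)
    have "finite (fixed_points X T n)"
      using assms by (simp add: finite_fixed_points_def)
    then show "finite (least_period_points X T n)"
      by (rule rev_finite_subset) (auto simp: least_period_points_def)
  qed (rule \<open>n > 0\<close>)
  ultimately show ?thesis
    by simp
qed

section \<open>Discrete systems\<close>

lemma fixed_points_transfer:
  assumes "inj f" "T ` A \<subseteq> A"
  shows "fixed_points (discrete_topology (f ` A)) (f \<circ> T \<circ> inv f) n = f ` {x \<in> A. (T ^^ n) x = x}"
proof -
  have "((f \<circ> T \<circ> inv f) ^^ n) (f x) = f ((T ^^ n) x)" for x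
    using assms(1) by (induction n) auto
  then show ?thesis
    using assms(1) by (auto simp: fixed_points_def inj_eq)
qed

text \<open>Moves a purely combinatorial system and factor into the prescribed types by conjugating
  with injections. In discrete topologies continuity only asks that maps respect the
  carriers.\<close>

lemma relatively_realizable_if_discrete_factor:
  fixes f :: "'c \<Rightarrow> 'a" and g :: "'d \<Rightarrow> 'b" and A :: "'c set" and B :: "'d set"
  assumes "inj f" "inj g" and maps: "T ` A \<subseteq> A" "S ` B \<subseteq> B"
    and \<phi>: "\<phi> ` A = B" "\<And>x. x \<in> A \<Longrightarrow> \<phi> (T x) = S (\<phi> x)"
    and finite: "\<And>n. n \<ge> 1 \<Longrightarrow> finite {x \<in> A. (T ^^ n) x = x}"
      "\<And>n. n \<ge> 1 \<Longrightarrow> finite {y \<in> B. (S ^^ n) y = y}"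
    and h: "\<And>n. n \<ge> 1 \<Longrightarrow>
      h n = int (card {x \<in> A. (T ^^ n) x = x}) - int (card {y \<in> B. (S ^^ n) y = y})"
  shows "relatively_realizable TYPE('a) TYPE('b) h"
proof -
  define X where "X = discrete_topology (f ` A)"
  define Y where "Y = discrete_topology (g ` B)"
  define T' where "T' = f \<circ> T \<circ> inv f"
  define S' where "S' = g \<circ> S \<circ> inv g"
  have fixed: "fixed_points X T' n = f ` {x \<in> A. (T ^^ n) x = x}"
    "fixed_points Y S' n = g ` {y \<in> B. (S ^^ n) y = y}" for n
    unfolding X_def Y_def T'_def S'_def by (intro fixed_points_transfer assms)+
  have "is_factor X T' Y S'"
    unfolding is_factor_def
  proof (intro conjI exI[of _ "g \<circ> \<phi> \<circ> inv f"] ballI)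
    show "dynamical_system X T'" "dynamical_system Y S'" "continuous_map X Y (g \<circ> \<phi> \<circ> inv f)"
      using assms(1,2) maps \<phi>(1)
      by (simp_all add: dynamical_system_def X_def Y_def T'_def S'_def image_subset_iff Pi_iff) blast
    show "(g \<circ> \<phi> \<circ> inv f) ` topspace X = topspace Y"
      using \<open>inj f\<close> \<phi>(1) by (auto simp: X_def Y_def image_comp)
    show "(g \<circ> \<phi> \<circ> inv f) (T' x) = S' ((g \<circ> \<phi> \<circ> inv f) x)" if "x \<in> topspace X" for x
      using that assms(1,2) \<phi>(2) by (auto simp: X_def T'_def S'_def)
  qed
  moreover have "finite_fixed_points X T'" "finite_fixed_points Y S'"
    using finite by (simp_all add: finite_fixed_points_def fixed)
  moreover have "h n = int (fixed_point_count X T' n) - int (fixed_point_count Y S' n)" if "n \<ge> 1" for n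
    using h[OF that] assms(1,2) by (simp add: fixed_point_count_def fixed card_image inj_on_subset[OF _ subset_UNIV])
  ultimately show ?thesis
    unfolding relatively_realizable_def by blast
qed

text \<open>
  A point \<open>(n, i, j)\<close> has position \<open>j\<close> in the \<open>i\<close>-th component of index \<open>n\<close>. The first \<open>p n\<close>
  of these components are cycles of length \<open>n\<close>, the others are infinite rays.
\<close>

definition step :: "(nat \<Rightarrow> nat) \<Rightarrow> nat \<times> nat \<times> nat \<Rightarrow> nat \<times> nat \<times> nat" where
  "step p = (\<lambda>(n, i, j). (n, i, if i < p n then Suc j mod n else Suc j))"

definition cycles :: "(nat \<Rightarrow> nat) \<Rightarrow> (nat \<times> nat \<times> nat) set" where
  "cycles p = {(n, i, j). i < p n \<and> j < n}"

text \<open>Ray \<open>p n + i\<close> is meant to wrap around cycle \<open>i\<close> of length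
  \<open>n\<close> in \<open>cycles q\<close>. Positions are unbounded, so \<open>0 < n\<close> must
  be required here, while \<open>j < n\<close> implies it in \<open>cycles\<close>.\<close>

definition rays :: "(nat \<Rightarrow> nat) \<Rightarrow> (nat \<Rightarrow> nat) \<Rightarrow> (nat \<times> nat \<times> nat) set" where
  "rays p q = {(n, i, j). 0 < n \<and> p n \<le> i \<and> i < p n + q n}"

text \<open>The assumption makes the case \<open>m = 0\<close> true, where \<open>j mod n\<close>
  has to equal \<open>j\<close>.\<close>

lemma funpow_step:
  assumes "i < p n \<Longrightarrow> j < n"
  shows "(step p ^^ m) (n, i, j) = (n, i, if i < p n then (j + m) mod n else j + m)"
  using assms by (induction m) (auto simp: step_def mod_Suc_eq)

lemma step_in_cycles: "step p ` cycles p \<subseteq> cycles p"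
  by (auto simp: step_def cycles_def)

lemma step_in_cycles_Un_rays: "step p ` (cycles p \<union> rays p q) \<subseteq> cycles p \<union> rays p q"
  by (auto simp: step_def cycles_def rays_def)

text \<open>A cycle of length \<open>n\<close> is fixed pointwise if \<open>n\<close> divides
  \<open>m\<close> and has no fixed point otherwise. The \<open>SIGMA\<close> form makes finiteness
  and cardinality immediate.\<close>

lemma fixed_cycles:
  "{x \<in> cycles p. (step p ^^ m) x = x} = (SIGMA n:{n. n dvd m}. {..<p n} \<times> {..<n})"
proof -
  have "(j + m) mod n = j \<longleftrightarrow> n dvd m" if "j < n" for j n
  proof -
    have "(j + m) mod n = j \<longleftrightarrow> (j + m) mod n = (j + 0) mod n"
      using that by simp
    also have "\<dots> \<longleftrightarrow> n dvd m"
      by (metis add_diff_cancel_left' add.right_neutral le_add1 mod_eq_dvd_iff_nat)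
    finally show ?thesis .
  qed
  then show ?thesis
    by (auto simp: cycles_def funpow_step)
qed

text \<open>On a ray the position grows by \<open>m > 0\<close>, so nothing returns.\<close>

lemma fixed_cycles_Un_rays:
  assumes "m > 0"
  shows "{x \<in> cycles p \<union> rays p q. (step p ^^ m) x = x} = {x \<in> cycles p. (step p ^^ m) x = x}"
  using assms by (auto simp: cycles_def rays_def funpow_step)

lemma card_fixed_cycles:
  assumes "m > 0"
  shows "finite {x \<in> cycles p. (step p ^^ m) x = x}"
    and "card {x \<in> cycles p. (step p ^^ m) x = x} = (\<Sum>n | n dvd m. p n * n)"
  using assms by (simp_all add: fixed_cycles)

theorem theorem2p2:
  fixes h :: "nat \<Rightarrow> int"
  assumes "infinite (UNIV :: 'a set)" and "infinite (UNIV :: 'b set)"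
  shows "relatively_realizable TYPE('a) TYPE('b) h \<longleftrightarrow> (\<forall>n\<ge>1. orb h n \<in> \<int>)"
proof
  assume "relatively_realizable TYPE('a) TYPE('b) h"
  then obtain X :: "'a topology" and T and Y :: "'b topology" and S
    where XY: "dynamical_system X T" "dynamical_system Y S"
      "finite_fixed_points X T" "finite_fixed_points Y S"
      and h: "\<And>n. n \<ge> 1 \<Longrightarrow> h n = int (fixed_point_count X T n) - int (fixed_point_count Y S n)"
    unfolding relatively_realizable_def is_factor_def by blast
  show "\<forall>n\<ge>1. orb h n \<in> \<int>"
  proof (intro allI impI)
    fix n :: nat assume "n \<ge> 1"
    then have "(\<Sum>d | d dvd n. moebius (n div d) * h d)
        = (\<Sum>d | d dvd n. moebius (n div d) * int (fixed_point_count X T d)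
            - moebius (n div d) * int (fixed_point_count Y S d))"
      by (intro sum.cong) (auto simp: h algebra_simps dvd_pos_nat Suc_le_eq)
    then have "int n dvd (\<Sum>d | d dvd n. moebius (n div d) * h d)"
      using XY \<open>n \<ge> 1\<close> by (simp add: sum_subtractf dvd_diff dvd_sum_moebius_fixed_point_count)
    then show "orb h n \<in> \<int>"
      using \<open>n \<ge> 1\<close> by (simp add: orb_in_Ints_iff)
  qed
next
  assume orb: "\<forall>n\<ge>1. orb h n \<in> \<int>"
  \<comment> \<open>\<open>s n\<close> is \<open>n * orb h n\<close>, so by integrality
    \<open>c n\<close> is \<open>orb h n\<close> as an integer.\<close>
  define s where "s n = (\<Sum>d | d dvd n. moebius (n div d) * h d)" for n
  define c where "c n = s n div int n" for n
  have c: "c n * int n = s n" if "n > 0" for n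
    using orb that by (simp add: c_def s_def orb_in_Ints_iff Suc_le_eq)
  \<comment> \<open>The added 1 provides a fixed point \<open>(1, 0, 0)\<close> in \<open>cycles q\<close>.\<close>
  define p where "p n = Suc (nat (c n))" for n
  define q where "q n = Suc (nat (- c n))" for n
  \<comment> \<open>Cycles collapse to the fixed point; a ray winds around its cycle by reducing
    positions modulo \<open>n\<close>.\<close>
  define \<phi> :: "nat \<times> nat \<times> nat \<Rightarrow> nat \<times> nat \<times> nat" where
    "\<phi> = (\<lambda>(n, i, j). if i < p n then (1, 0, 0) else (n, i - p n, j mod n))"
  \<comment> \<open>Both carriers lie in a countable type, which embeds into every infinite type
    through \<open>to_nat\<close>.\<close>
  obtain f :: "nat \<Rightarrow> 'a" where "inj f"
    using infinite_countable_subset[OF assms(1)] by blast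
  obtain g :: "nat \<Rightarrow> 'b" where "inj g"
    using infinite_countable_subset[OF assms(2)] by blast
  show "relatively_realizable TYPE('a) TYPE('b) h"
  proof (rule relatively_realizable_if_discrete_factor
      [where f = "f \<circ> to_nat" and g = "g \<circ> to_nat" and A = "cycles p \<union> rays p q" and B = "cycles q"
        and T = "step p" and S = "step q" and \<phi> = \<phi>])
    show "inj (f \<circ> to_nat :: nat \<times> nat \<times> nat \<Rightarrow> 'a)" "inj (g \<circ> to_nat :: nat \<times> nat \<times> nat \<Rightarrow> 'b)"
      using \<open>inj f\<close> \<open>inj g\<close> by (auto intro: inj_compose)
    show "\<phi> ` (cycles p \<union> rays p q) = cycles q"
    proof (intro equalityI subsetI)
      fix y assume "y \<in> cycles q"
      then obtain n i j where y: "y = (n, i, j)" "i < q n" "j < n"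
        by (auto simp: cycles_def)
      \<comment> \<open>The preimage lies on the ray over the cycle, within its first
        \<open>n\<close> positions.\<close>
      then have "y = \<phi> (n, p n + i, j)" "(n, p n + i, j) \<in> rays p q"
        by (auto simp: \<phi>_def rays_def)
      then show "y \<in> \<phi> ` (cycles p \<union> rays p q)"
        by blast
    qed (auto simp: \<phi>_def cycles_def rays_def q_def)
    show "\<phi> (step p x) = step q (\<phi> x)" if "x \<in> cycles p \<union> rays p q" for x
      using that by (auto simp: \<phi>_def step_def cycles_def rays_def q_def mod_Suc_eq)
    show "h n = int (card {x \<in> cycles p \<union> rays p q. (step p ^^ n) x = x})
        - int (card {y \<in> cycles q. (step q ^^ n) y = y})" if "n \<ge> 1" for n
    proof -
      have "h n = (\<Sum>d | d dvd n. s d)"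
        using that moebius_inversion'[of n s h] by (simp add: s_def)
      \<comment> \<open>The added ones cancel and \<open>nat (c d)\<close>,
        \<open>nat (- c d)\<close> are the positive and negative parts of \<open>c d\<close>, so
        \<open>p d - q d\<close> is \<open>c d\<close> over the integers.\<close>
      also have "\<dots> = (\<Sum>d | d dvd n. int (p d * d) - int (q d * d))"
        using that by (intro sum.cong)
          (auto simp: p_def q_def algebra_simps dvd_pos_nat simp flip: c)
      finally show ?thesis
        using that by (simp add: fixed_cycles_Un_rays card_fixed_cycles sum_subtractf del: Un_iff)
    qed
  qed (simp_all add: step_in_cycles step_in_cycles_Un_rays fixed_cycles_Un_rays card_fixed_cycles del: Un_iff)
qed

end
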